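(* Let $K$ be a commutative $\mathbb{Q}$-algebra, $A$ a finite set and $\mathbf{s}=(s_a)_{a\in A}$ scalars in $K$. In $\mathcal{H}(A\times\mathbb{Z}_{\ge1})[[x]]$ consider the system \[ T_a(x)=1+\sum_{k\ge1}x^kB_+^{(a,k)}\big(T_a(x)Q(x)^k\big),\qquad Q(x)=\prod_{a\in A}T_a(x)^{s_a}. \] Its solution is given by \[ T_a(x)=1+\sum_{t:\ \alpha(\operatorname{rt}(t))=a}\Big(\prod_{v\in V(t)}\xi(v,\mathbf{s})\Big)\frac{t\,x^{w(t)}}{|\operatorname{Aut}(t)|}, \] the sum running over $(A\times\mathbb{Z}_{\ge1})$-decorated rooted trees whose root has type $a$.
   Context: A rooted tree is a root vertex with a possibly empty multiset of rooted trees as children. A $(A\times\mathbb{Z}_{\ge1})$-decorated rooted tree has a decoration $(\alpha(v),w(v))$ at each vertex; $\alpha(v)$ is the type and $w(v)$ the weight; $w(t)=\sum_v w(v)$. $\operatorname{Aut}(t)$ is the group of root- and decoration-preserving automorphisms. $\mathcal{H}(D)$ is the free commutative $K$-algebra generated by $D$-decorated rooted trees (products = forests, $1$ = empty forest); $B_+^{(d)}$ sends a forest to the tree obtained by adding a new root decorated $d$ joined to the roots of all components. Powers $T^p$ for $T\in 1+x\mathcal{H}[[x]]$ and scalar $p$ are defined by the binomial series. Write $\mathrm{od}_a(v)$ for the number of children of $v$ of type $a$, $(y)_k=y(y-1)\cdots(y-k+1)$, and \[ \xi(v,\mathbf{s})=(1+s_{\alpha(v)}w(v))_{\mathrm{od}_{\alpha(v)}(v)}\prod_{a\ne\alpha(v)}(s_aw(v))_{\mathrm{od}_a(v)}.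 \] *)

theory Defs
  imports
    "HOL-Analysis.Analysis"
    "HOL-Library.Multiset"
    "HOL-Library.Poly_Mapping"
    "HOL-Combinatorics.Permutations"
    "HOL-Computational_Algebra.Formal_Power_Series"
begin

text \<open>Commutative \<open>\<rat>\<close>-algebras, given by their structure map \<open>\<rat> \<rightarrow> K\<close>.\<close>

class comm_rat_algebra = comm_ring_1 +
  fixes rat_map :: "rat \<Rightarrow> 'a"
  assumes rat_map_one: "rat_map 1 = 1"
    and rat_map_add: "rat_map (p + q) = rat_map p + rat_map q"
    and rat_map_mult: "rat_map (p * q) = rat_map p * rat_map q"

instantiation rat :: comm_rat_algebra
begin
definition rat_map_rat :: "rat \<Rightarrow> rat" where "rat_map_rat q = q"
instance by standard (simp_all add: rat_map_rat_def)
end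

typedef posnat = "{n::nat. 1 \<le> n}"
  morphisms nat_of_posnat posnat_of_nat
  by auto

datatype 'd rtree = Node (root_dec: 'd) (subtrees: "'d rtree multiset")

text \<open>
  A vertex is addressed by the path leading to it from the root. A step of the path selects one
  child, i.e. one of the \<open>count ts c\<close> copies of some tree \<open>c\<close> in the multiset \<open>ts\<close> of children,
  and is recorded as \<open>(c, i)\<close> with \<open>i < count ts c\<close>. The root is the empty path.
\<close>

type_synonym 'd vertex = "('d rtree \<times> nat) list"

inductive is_vertex :: "'d rtree \<Rightarrow> 'd vertex \<Rightarrow> bool" where
  root: "is_vertex t []"
| step: "i < count ts c \<Longrightarrow> is_vertex c p \<Longrightarrow> is_vertex (Node d ts) ((c, i) # p)"

definition vertices :: "'d rtree \<Rightarrow> 'd vertex set" where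
  "vertices t = {v. is_vertex t v}"

definition child_of :: "'d vertex \<Rightarrow> 'd vertex \<Rightarrow> bool" where
  "child_of u v \<longleftrightarrow> (\<exists>e. u = v @ [e])"

definition dec :: "'d rtree \<Rightarrow> 'd vertex \<Rightarrow> 'd" where
  "dec t v = (if v = [] then root_dec t else root_dec (fst (last v)))"

lemma finite_vertices: "finite (vertices t)"
proof (induction t)
  case (Node d ts)
  have "vertices (Node d ts) \<subseteq> insert []
      (\<Union>c\<in>set_mset ts. \<Union>i\<in>{..<count ts c}. (\<lambda>p. (c, i) # p) ` vertices c)" (is "_ \<subseteq> ?S")
  proof
    fix v assume "v \<in> vertices (Node d ts)"
    then have "is_vertex (Node d ts) v"
      by (simp add: vertices_def)
    then show "v \<in> ?S"
    proof cases
      case root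
      then show ?thesis by simp
    next
      case (step i c p)
      have "c \<in># ts"
        using step(2) by (cases "c \<in># ts") (simp_all add: not_in_iff)
      with step show ?thesis
        by (auto simp: vertices_def)
    qed
  qed
  moreover have "finite ?S"
    using Node.IH by simp
  ultimately show ?case
    by (rule finite_subset)
qed

text \<open>
  \<open>permutes\<close> makes an automorphism the identity outside the vertex set, so that each one is
  counted exactly once.
\<close>

definition Aut :: "'d rtree \<Rightarrow> ('d vertex \<Rightarrow> 'd vertex) set" where
  "Aut t = {f. f permutes vertices t \<and> f [] = [] \<and>
     (\<forall>u\<in>vertices t. \<forall>v\<in>vertices t. child_of (f u) (f v) \<longleftrightarrow> child_of u v) \<and>
     (\<forall>v\<in>vertices t. dec t (f v) = dec t v)}"

type_synonym 'a dtree = "('a \<times> posnat) rtree"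

definition vtype :: "'a dtree \<Rightarrow> ('a \<times> posnat) vertex \<Rightarrow> 'a" where
  "vtype t v = fst (dec t v)"

definition vweight :: "'a dtree \<Rightarrow> ('a \<times> posnat) vertex \<Rightarrow> nat" where
  "vweight t v = nat_of_posnat (snd (dec t v))"

definition weight :: "'a dtree \<Rightarrow> nat" where
  "weight t = (\<Sum>v\<in>vertices t. vweight t v)"

definition od :: "'a dtree \<Rightarrow> 'a \<Rightarrow> ('a \<times> posnat) vertex \<Rightarrow> nat" where
  "od t a v = card {u \<in> vertices t. child_of u v \<and> vtype t u = a}"

definition falling :: "'k::comm_ring_1 \<Rightarrow> nat \<Rightarrow> 'k" where
  "falling y k = (\<Prod>i<k. y - of_nat i)"

definition xi :: "('a::finite \<Rightarrow> 'k::comm_ring_1) \<Rightarrow> 'a dtree \<Rightarrow> ('a \<times> posnat) vertex \<Rightarrow> 'k" where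
  "xi s t v =
     falling (1 + s (vtype t v) * of_nat (vweight t v)) (od t (vtype t v) v) *
     (\<Prod>a \<in> UNIV - {vtype t v}. falling (s a * of_nat (vweight t v)) (od t a v))"

text \<open>
  The free commutative algebra on the trees is the monoid algebra of the free commutative monoid
  of forests (multisets of trees); the empty forest \<open>{#} = 0\<close> gives its unit.
\<close>

type_synonym ('d, 'k) H = "'d rtree multiset \<Rightarrow>\<^sub>0 'k"

definition scalar :: "'k::zero \<Rightarrow> ('d, 'k) H" where
  "scalar c = Poly_Mapping.single {#} c"

definition of_tree :: "'d rtree \<Rightarrow> ('d, 'k::zero_neq_one) H" where
  "of_tree t = Poly_Mapping.single {#t#} 1"

definition B_plus :: "'d \<Rightarrow> ('d, 'k::comm_monoid_add) H \<Rightarrow> ('d, 'k) H" where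
  "B_plus d h = (\<Sum>F\<in>Poly_Mapping.keys h.
     Poly_Mapping.single {#Node d F#} (Poly_Mapping.lookup h F))"

definition B_plus_fps :: "'d \<Rightarrow> ('d, 'k::comm_monoid_add) H fps \<Rightarrow> ('d, 'k) H fps" where
  "B_plus_fps d f = Abs_fps (\<lambda>n. B_plus d (fps_nth f n))"

definition binomial_series :: "'k::comm_rat_algebra \<Rightarrow> ('d, 'k) H fps" where
  "binomial_series p = Abs_fps (\<lambda>n. scalar (rat_map (1 / of_nat (fact n)) * falling p n))"

text \<open>Meaningful only if \<open>T\<close> has constant term \<open>1\<close>.\<close>

definition fps_scalar_power ::
    "('d, 'k::comm_rat_algebra) H fps \<Rightarrow> 'k \<Rightarrow> ('d, 'k) H fps" where
  "fps_scalar_power T p = binomial_series p oo (T - 1)"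

definition Q_series ::
    "('a::finite \<Rightarrow> 'k::comm_rat_algebra) \<Rightarrow> ('a \<Rightarrow> ('a \<times> posnat, 'k) H fps)
      \<Rightarrow> ('a \<times> posnat, 'k) H fps" where
  "Q_series s T = (\<Prod>a\<in>UNIV. fps_scalar_power (T a) (s a))"

text \<open>
  Infinite sums of power series are taken in the \<open>x\<close>-adic topology, which is the topology of the
  library's metric on \<open>fps\<close>.
\<close>

definition solves_system ::
    "('a::finite \<Rightarrow> 'k::comm_rat_algebra) \<Rightarrow> ('a \<Rightarrow> ('a \<times> posnat, 'k) H fps) \<Rightarrow> bool" where
  "solves_system s T \<longleftrightarrow>
     (\<forall>a. fps_nth (T a) 0 = 1) \<and>
     (\<forall>a. ((\<lambda>k. fps_X ^ nat_of_posnat k *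
              B_plus_fps (a, k) (T a * Q_series s T ^ nat_of_posnat k))
           has_sum (T a - 1)) UNIV)"

definition tree_term ::
    "('a::finite \<Rightarrow> 'k::comm_rat_algebra) \<Rightarrow> 'a dtree \<Rightarrow> ('a \<times> posnat, 'k) H fps" where
  "tree_term s t =
     fps_const (scalar ((\<Prod>v\<in>vertices t. xi s t v) * rat_map (1 / of_nat (card (Aut t))))
       * of_tree t) * fps_X ^ weight t"

end

theory Submission
  imports Defs
begin

text \<open>
  Write \<open>c(t)\<close> for the claimed coefficient of a tree \<open>t\<close>. Splitting off the root multiplies
  \<open>c\<close> over the children \<open>F\<close>, divided by the factorials of their multiplicities, with one
  falling factorial per type: \<open>c(Node (a, k) F) = (\<Prod>\<^sub>b (p\<^sub>b)\<^sub>n\<^sub>b) W(F)\<close>, where \<open>n\<^sub>b\<close> counts the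
  children of type \<open>b\<close>, \<open>p\<^sub>b = [a = b] + k s\<^sub>b\<close>, and \<open>W(F) = \<Prod>\<^sub>t c(t)\<^sup>m / m!\<close> over the distinct
  children \<open>t\<close> of multiplicity \<open>m\<close>. On the other hand the \<open>n\<close>-th power of the series of all
  trees of type \<open>b\<close> has coefficient \<open>n! W(F)\<close> at each forest \<open>F\<close> of \<open>n\<close> such trees, so the
  binomial series gives \<open>T\<^sub>b\<close> to the power \<open>p\<close> the coefficient \<open>(p)\<^sub>n W(F)\<close>. Hence
  \<open>T\<^sub>a Q\<^sup>k\<close>, the product over \<open>b\<close> of \<open>T\<^sub>b\<close> to the power \<open>p\<^sub>b\<close>, has coefficient
  \<open>c(Node (a, k) F)\<close> at \<open>F\<close>. The solution is unique because the coefficient of \<open>x\<^sup>n\<close> on the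
  right-hand side involves only lower coefficients of the \<open>T\<^sub>a\<close>.
\<close>

subsection \<open>Automorphisms of a tree\<close>

text \<open>The possible first steps of a vertex address below a node with children
  \<open>M\<close>, one per copy. They turn sums and products over children with multiplicity into
  ones over a set.\<close>

definition slots :: "'b multiset \<Rightarrow> ('b \<times> nat) set" where
  "slots M = (SIGMA c:set_mset M. {..<count M c})"

lemma slots_iff: "e \<in> slots M \<longleftrightarrow> snd e < count M (fst e)"
  by (cases e, cases "fst e \<in># M") (auto simp: slots_def not_in_iff)

lemma finite_slots [simp]: "finite (slots M)"
  by (simp add: slots_def)

lemma card_slots_fst: "card {e \<in> slots M. fst e = c} = count M c"
proof -
  have "{e \<in> slots M. fst e = c} = Pair c ` {..<count M c}"
    by (auto simp: slots_iff)
  then show ?thesis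
    by (simp add: card_image inj_on_def)
qed

lemma prod_slots: "(\<Prod>e\<in>slots M. f (fst e)) = (\<Prod>c\<in>#M. f c)"
proof -
  have "(\<Prod>e\<in>slots M. f (fst e)) = (\<Prod>c\<in>set_mset M. \<Prod>i<count M c. f c)"
    unfolding slots_def by (subst prod.Sigma) (auto intro: prod.cong)
  then show ?thesis
    by (simp add: image_prod_mset_multiplicity)
qed

lemma sum_slots: "(\<Sum>e\<in>slots M. f (fst e)) = (\<Sum>c\<in>#M. f c :: nat)"
proof (induction M)
  case (add c M)
  \<comment> \<open>The new copy of \<open>c\<close> takes the next free index.\<close>
  have "slots (add_mset c M) = insert (c, count M c) (slots M)"
    by (auto simp: slots_iff split: if_splits)
  then show ?case
    using add by (simp add: slots_iff)
qed (simp add: slots_def)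

section \<open>Vertex addresses of a node\<close>

lemma Nil_in_vertices [simp]: "[] \<in> vertices t"
  by (simp add: vertices_def is_vertex.root)

lemma Cons_in_vertices [simp]:
  "e # p \<in> vertices (Node d F) \<longleftrightarrow> e \<in> slots F \<and> p \<in> vertices (fst e)"
  by (cases e) (auto simp: vertices_def slots_iff elim: is_vertex.cases intro: is_vertex.step)

lemma vertices_Node:
  "vertices (Node d F) = insert [] (\<Union>e\<in>slots F. (#) e ` vertices (fst e))"
proof (rule set_eqI)
  fix v show "v \<in> vertices (Node d F) \<longleftrightarrow>
      v \<in> insert [] (\<Union>e\<in>slots F. (#) e ` vertices (fst e))"
    by (cases v) auto
qed

lemma prod_vertices_Node:
  "(\<Prod>v\<in>vertices (Node d F). f v) = f [] * (\<Prod>e\<in>slots F. \<Prod>p\<in>vertices (fst e). f (e # p))"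
  unfolding vertices_Node
  by (subst prod.insert, simp add: finite_vertices, force,
      subst prod.UNION_disjoint) (auto simp: finite_vertices prod.reindex)

lemma sum_vertices_Node:
  "(\<Sum>v\<in>vertices (Node d F). f v) = f [] + (\<Sum>e\<in>slots F. \<Sum>p\<in>vertices (fst e). f (e # p))"
  unfolding vertices_Node
  by (subst sum.insert, simp add: finite_vertices, force,
      subst sum.UNION_disjoint) (auto simp: finite_vertices sum.reindex)

lemma vertices_prefix: "v @ w \<in> vertices t \<Longrightarrow> v \<in> vertices t"
proof (induction v arbitrary: t)
  case (Cons e v)
  then show ?case by (cases t) auto
qed simp

lemma child_of_simps [simp]:
  "\<not> child_of [] v"
  "child_of (e # p) [] \<longleftrightarrow> p = []"
  "child_of (e # p) (e' # p') \<longleftrightarrow> e = e' \<and> child_of p p'"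
  by (auto simp: child_of_def)

lemma dec_simps [simp]:
  "dec t [] = root_dec t"
  "dec (Node d F) (e # p) = dec (fst e) p"
  by (auto simp: dec_def)

section \<open>Isomorphisms of trees\<close>

text \<open>Two trees are allowed because an automorphism may carry one child subtree to another.
  Unlike in \<open>Aut\<close>, values outside the vertex set are left free.\<close>

definition tree_iso :: "'d rtree \<Rightarrow> 'd rtree \<Rightarrow> ('d vertex \<Rightarrow> 'd vertex) \<Rightarrow> bool" where
  "tree_iso t u f \<longleftrightarrow> bij_betw f (vertices t) (vertices u) \<and> f [] = [] \<and>
     (\<forall>v\<in>vertices t. \<forall>w\<in>vertices t. child_of (f v) (f w) \<longleftrightarrow> child_of v w) \<and>
     (\<forall>v\<in>vertices t. dec u (f v) = dec t v)"

lemma Aut_iff: "f \<in> Aut t \<longleftrightarrow> tree_iso t t f \<and> (\<forall>v. v \<notin> vertices t \<longrightarrow> f v = v)"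
  unfolding Aut_def tree_iso_def
  by (auto simp: permutes_imp_bij permutes_not_in intro: bij_imp_permutes)

lemma tree_iso_in: "tree_iso t u f \<Longrightarrow> v \<in> vertices t \<Longrightarrow> f v \<in> vertices u"
  by (auto simp: tree_iso_def bij_betw_def)

lemma tree_iso_eq_iff:
  "tree_iso t u f \<Longrightarrow> v \<in> vertices t \<Longrightarrow> w \<in> vertices t \<Longrightarrow> f v = f w \<longleftrightarrow> v = w"
  by (auto simp: tree_iso_def bij_betw_def inj_on_def)

lemma tree_iso_surj:
  assumes "tree_iso t u f" "w \<in> vertices u"
  obtains v where "v \<in> vertices t" "f v = w"
  using assms by (metis tree_iso_def bij_betw_def imageE)

lemma tree_iso_Nil: "tree_iso t u f \<Longrightarrow> f [] = []"
  by (simp add: tree_iso_def)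

lemma tree_iso_child:
  "tree_iso t u f \<Longrightarrow> v \<in> vertices t \<Longrightarrow> w \<in> vertices t \<Longrightarrow> child_of (f v) (f w) \<longleftrightarrow> child_of v w"
  by (simp add: tree_iso_def)

lemma tree_iso_dec: "tree_iso t u f \<Longrightarrow> v \<in> vertices t \<Longrightarrow> dec u (f v) = dec t v"
  by (simp add: tree_iso_def)

lemma tree_iso_snoc:
  assumes "tree_iso t u f" "v @ [e] \<in> vertices t"
  shows "\<exists>e'. f (v @ [e]) = f v @ [e']"
  using tree_iso_child[OF assms vertices_prefix[OF assms(2)]] by (auto simp: child_of_def)

lemma tree_iso_length:
  assumes "tree_iso t u f" "v \<in> vertices t"
  shows "length (f v) = length v"
  using assms(2)
proof (induction v rule: rev_induct)
  case Nil
  then show ?case by (simp add: tree_iso_Nil[OF assms(1)])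
next
  case (snoc e v)
  then show ?case
    using tree_iso_snoc[OF assms(1) snoc.prems] vertices_prefix[OF snoc.prems] by auto
qed

text \<open>Extending an address by one step extends its image by one step, so along a path the
  first step of the image stays that of \<open>f [e]\<close>.\<close>

lemma tree_iso_hd:
  assumes "tree_iso t u f" "e # p \<in> vertices t"
  shows "f (e # p) = hd (f [e]) # tl (f (e # p))"
  using assms(2)
proof (induction p rule: rev_induct)
  case Nil
  then show ?case using tree_iso_length[OF assms(1) Nil.prems] by (cases "f [e]") auto
next
  case (snoc x p)
  have v: "(e # p) @ [x] \<in> vertices t"
    using snoc.prems by simp
  obtain y where "f ((e # p) @ [x]) = f (e # p) @ [y]"
    using tree_iso_snoc[OF assms(1) v] by blast
  then show ?case
    using snoc.IH[OF vertices_prefix[OF v]] by (metis append_Cons list.sel(1,3))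
qed

text \<open>By \<open>tree_iso_hd\<close>, \<open>f\<close> splits into a map \<open>pi\<close> of
  slots and one map \<open>g e\<close> per child subtree; bijectivity, the child relation and
  decorations pass to the pieces.\<close>

lemma tree_iso_Node:
  fixes f :: "'d vertex \<Rightarrow> 'd vertex"
  assumes f: "tree_iso (Node d F) (Node d' F') f"
  shows "bij_betw (\<lambda>e. hd (f [e])) (slots F) (slots F')"
    and "\<And>e. e \<in> slots F \<Longrightarrow> tree_iso (fst e) (fst (hd (f [e]))) (\<lambda>p. tl (f (e # p)))"
proof -
  define pi where "pi e = hd (f [e])" for e
  define g where "g e p = tl (f (e # p))" for e p
  have fe: "f (e # p) = pi e # g e p" if "e \<in> slots F" "p \<in> vertices (fst e)" for e p
    unfolding pi_def g_def by (rule tree_iso_hd[OF f]) (use that in simp)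
  have mem: "pi e \<in> slots F'" "g e p \<in> vertices (fst (pi e))"
    if "e \<in> slots F" "p \<in> vertices (fst e)" for e p
    using tree_iso_in[OF f, of "e # p"] that by (auto simp: fe)
  have gNil: "g e [] = []" if "e \<in> slots F" for e
    using tree_iso_length[OF f, of "[e]"] that by (auto simp: fe)
  have inj: "pi e = pi e' \<and> g e p = g e' p' \<longleftrightarrow> e = e' \<and> p = p'"
    if "e \<in> slots F" "p \<in> vertices (fst e)" "e' \<in> slots F" "p' \<in> vertices (fst e')" for e e' p p'
    using tree_iso_eq_iff[OF f, of "e # p" "e' # p'"] that by (auto simp: fe)
  have pi_inj: "e = e'" if "pi e = pi e'" "e \<in> slots F" "e' \<in> slots F" for e e'
    using inj[of e "[]" e' "[]"] that by (simp add: gNil)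
  have surj: "\<exists>e p. e \<in> slots F \<and> p \<in> vertices (fst e) \<and> pi e = x \<and> g e p = q"
    if xq: "x \<in> slots F'" "q \<in> vertices (fst x)" for x q
  proof -
    obtain v where v: "v \<in> vertices (Node d F)" "f v = x # q"
      using tree_iso_surj[OF f, of "x # q"] xq by (metis Cons_in_vertices)
    then obtain e p where "v = e # p"
      using tree_iso_Nil[OF f] by (cases v) auto
    with v have "e \<in> slots F \<and> p \<in> vertices (fst e) \<and> pi e = x \<and> g e p = q"
      by (auto simp: fe)
    then show ?thesis by blast
  qed
  show "bij_betw (\<lambda>e. hd (f [e])) (slots F) (slots F')"
    unfolding pi_def[symmetric] bij_betw_def
  proof (intro conjI inj_onI subset_antisym subsetI)
    fix x assume "x \<in> slots F'"
    then show "x \<in> pi ` slots F"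
      using surj[of x "[]"] by auto
  qed (use mem(1)[of _ "[]"] pi_inj in auto)
  fix e assume e: "e \<in> slots F"
  have "tree_iso (fst e) (fst (pi e)) (g e)"
    unfolding tree_iso_def
  proof (intro conjI ballI)
    show "bij_betw (g e) (vertices (fst e)) (vertices (fst (pi e)))"
      unfolding bij_betw_def
    proof (intro conjI inj_onI subset_antisym subsetI)
      \<comment> \<open>The preimage of \<open>pi e # q\<close> starts at some slot
        \<open>e'\<close>, and injectivity of \<open>pi\<close> forces
        \<open>e' = e\<close>.\<close>
      fix q assume "q \<in> vertices (fst (pi e))"
      then obtain e' p where "e' \<in> slots F" "p \<in> vertices (fst e')" "pi e' = pi e" "g e' p = q"
        using surj[of "pi e" q] mem(1)[OF e] Nil_in_vertices by blast
      then show "q \<in> g e ` vertices (fst e)"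
        using pi_inj[of e' e] e by auto
    qed (use mem[OF e] inj[OF e _ e] in auto)
    fix p q assume pq: "p \<in> vertices (fst e)" "q \<in> vertices (fst e)"
    show "child_of (g e p) (g e q) \<longleftrightarrow> child_of p q"
      using tree_iso_child[OF f, of "e # p" "e # q"] pq e by (simp add: fe)
  next
    fix p assume "p \<in> vertices (fst e)"
    then show "dec (fst (pi e)) (g e p) = dec (fst e) p"
      using tree_iso_dec[OF f, of "e # p"] e by (simp add: fe)
  qed (rule gNil[OF e])
  then show "tree_iso (fst e) (fst (hd (f [e]))) (\<lambda>p. tl (f (e # p)))"
    by (simp add: pi_def g_def[abs_def])
qed

text \<open>Children matched by \<open>pi\<close> are isomorphic, hence equal by induction. So
  \<open>pi\<close> maps the copies of each \<open>c\<close> in \<open>F\<close> bijectively to the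
  copies of \<open>c\<close> in \<open>F'\<close>, and the multiplicities agree.\<close>

lemma tree_iso_imp_eq: "tree_iso t u f \<Longrightarrow> t = u"
proof (induction t arbitrary: u f)
  case (Node d F)
  obtain d' F' where u: "u = Node d' F'"
    by (cases u)
  note f = Node.prems[unfolded u]
  define pi where "pi e = hd (f [e])" for e
  have bij: "bij_betw pi (slots F) (slots F')"
    and iso: "\<And>e. e \<in> slots F \<Longrightarrow> tree_iso (fst e) (fst (pi e)) (\<lambda>p. tl (f (e # p)))"
    unfolding pi_def by (rule tree_iso_Node[OF f])+
  have fst_pi: "fst (pi e) = fst e" if "e \<in> slots F" for e
    using Node.IH[of "fst e", OF _ iso[OF that]] that by (auto simp: slots_def)
  have "count F c = count F' c" for c
  proof -
    have "bij_betw pi {e \<in> slots F. fst e = c} {e \<in> slots F'. fst e = c}"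
      unfolding bij_betw_def
    proof
      show "inj_on pi {e \<in> slots F. fst e = c}"
        using bij by (auto simp: bij_betw_def inj_on_def)
      have "pi ` slots F = slots F'"
        using bij by (simp add: bij_betw_def)
      then show "pi ` {e \<in> slots F. fst e = c} = {e \<in> slots F'. fst e = c}"
        using fst_pi by (intro set_eqI iffI) (smt (verit) image_iff mem_Collect_eq)+
    qed
    then show ?thesis
      using bij_betw_same_card[of pi "{e \<in> slots F. fst e = c}" "{e \<in> slots F'. fst e = c}"]
      by (simp add: card_slots_fst)
  qed
  moreover have "d = d'"
    using tree_iso_dec[OF f, of "[]"] tree_iso_Nil[OF f] by simp
  ultimately show ?case
    by (simp add: u multiset_eq_iff)
qed

text \<open>
  An automorphism of \<open>Node d F\<close> permutes the copies of each child and acts on each copy by an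
  automorphism; equal copies suffice because isomorphic trees are equal.
\<close>

definition graft :: "'d rtree multiset \<Rightarrow> ('d rtree \<Rightarrow> (nat \<Rightarrow> nat) \<times> (nat \<Rightarrow> 'd vertex \<Rightarrow> 'd vertex))
    \<Rightarrow> 'd vertex \<Rightarrow> 'd vertex" where
  "graft F D v = (case v of [] \<Rightarrow> [] | e # p \<Rightarrow>
     if e \<in> slots F \<and> p \<in> vertices (fst e)
     then (fst e, fst (D (fst e)) (snd e)) # snd (D (fst e)) (snd e) p else v)"

text \<open>As a set, the product over the distinct children \<open>c\<close> of the wreath products
  of \<open>Aut c\<close> with the symmetric group on the copies of \<open>c\<close>. Extensional
  function spaces make each choice occur once.\<close>

definition graft_data ::
    "'d rtree multiset \<Rightarrow> ('d rtree \<Rightarrow> (nat \<Rightarrow> nat) \<times> (nat \<Rightarrow> 'd vertex \<Rightarrow> 'd vertex)) set" where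
  "graft_data F = (\<Pi>\<^sub>E c\<in>set_mset F. {p. p permutes {..<count F c}} \<times> (\<Pi>\<^sub>E i\<in>{..<count F c}. Aut c))"

text \<open>Each copy goes to a copy of the same child, where an automorphism acts, so everything
  can be checked on the first step and the remaining path separately. Surjectivity follows from
  injectivity by finiteness.\<close>

lemma graft_in_Aut:
  assumes D: "D \<in> graft_data F"
  shows "graft F D \<in> Aut (Node d F)"
proof -
  define pi where "pi e = (fst e, fst (D (fst e)) (snd e))" for e
  define g where "g e = snd (D (fst e)) (snd e)" for e
  have perm: "fst (D c) permutes {..<count F c}" if "c \<in># F" for c
    using D that by (auto simp: graft_data_def PiE_iff mem_Times_iff)
  have gA: "g e \<in> Aut (fst e)" if "e \<in> slots F" for e
    using D that by (fastforce simp: graft_data_def PiE_iff mem_Times_iff g_def slots_def)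
  then have iso: "tree_iso (fst e) (fst e) (g e)" if "e \<in> slots F" for e
    using that by (auto simp: Aut_iff)
  have fst_pi [simp]: "fst (pi e) = fst e" for e
    by (simp add: pi_def)
  have pi_in: "pi e \<in> slots F" if "e \<in> slots F" for e
    using permutes_in_image[OF perm[of "fst e"], of "snd e"] that by (auto simp: slots_def pi_def)
  have pi_inj: "pi e = pi e' \<longleftrightarrow> e = e'" if "e \<in> slots F" "e' \<in> slots F" for e e'
    using permutes_inj[OF perm[of "fst e"]] that
    by (auto simp: slots_def pi_def inj_eq prod_eq_iff)
  have gr: "graft F D (e # p) = pi e # g e p" if "e \<in> slots F" "p \<in> vertices (fst e)" for e p
    using that by (simp add: graft_def pi_def g_def)
  have gr_Nil [simp]: "graft F D [] = []"
    by (simp add: graft_def)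
  have g_Nil: "g e p = [] \<longleftrightarrow> p = []" if "e \<in> slots F" "p \<in> vertices (fst e)" for e p
    using tree_iso_eq_iff[OF iso, of e p "[]"] tree_iso_Nil[OF iso, of e] that by auto
  have inj: "inj_on (graft F D) (vertices (Node d F))"
  proof (rule inj_onI)
    fix v w assume "v \<in> vertices (Node d F)" "w \<in> vertices (Node d F)" "graft F D v = graft F D w"
    then show "v = w"
      by (cases v; cases w) (auto simp: gr pi_inj tree_iso_eq_iff[OF iso])
  qed
  have "graft F D ` vertices (Node d F) \<subseteq> vertices (Node d F)"
  proof (rule image_subsetI)
    fix v assume "v \<in> vertices (Node d F)"
    then show "graft F D v \<in> vertices (Node d F)"
      by (cases v) (auto simp: gr pi_in tree_iso_in[OF iso])
  qed
  then have "graft F D ` vertices (Node d F) = vertices (Node d F)"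
    using inj by (intro endo_inj_surj finite_vertices)
  moreover have "child_of (graft F D v) (graft F D w) \<longleftrightarrow> child_of v w"
    if "v \<in> vertices (Node d F)" "w \<in> vertices (Node d F)" for v w
    using that by (cases v; cases w) (auto simp: gr pi_inj g_Nil tree_iso_child[OF iso])
  moreover have "dec (Node d F) (graft F D v) = dec (Node d F) v"
    if "v \<in> vertices (Node d F)" for v
    using that by (cases v) (auto simp: gr tree_iso_dec[OF iso])
  moreover have "graft F D v = v" if "v \<notin> vertices (Node d F)" for v
    using that by (cases v) (auto simp: graft_def)
  ultimately show ?thesis
    using inj by (simp add: Aut_iff tree_iso_def bij_betw_def)
qed

text \<open>The value at \<open>(c, i) # p\<close> reveals both the new index and the image of
  \<open>p\<close>. Elsewhere the data are fixed by \<open>permutes\<close>, extensionality and the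
  convention in \<open>Aut\<close>.\<close>

lemma inj_on_graft: "inj_on (graft F) (graft_data F)"
proof (rule inj_onI)
  fix D E assume D: "D \<in> graft_data F" and E: "E \<in> graft_data F" and eq: "graft F D = graft F E"
  have *: "fst (D c) i = fst (E c) i \<and> snd (D c) i p = snd (E c) i p"
    if "i < count F c" "p \<in> vertices c" for c i p
    using fun_cong[OF eq, of "(c, i) # p"] that by (auto simp: graft_def slots_iff)
  show "D = E"
  proof (rule PiE_ext[OF D[unfolded graft_data_def] E[unfolded graft_data_def]])
    fix c assume c: "c \<in> set_mset F"
    have Dc: "fst (D c) permutes {..<count F c}" "snd (D c) \<in> (\<Pi>\<^sub>E i\<in>{..<count F c}. Aut c)"
      and Ec: "fst (E c) permutes {..<count F c}" "snd (E c) \<in> (\<Pi>\<^sub>E i\<in>{..<count F c}. Aut c)"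
      using D E c by (auto simp: graft_data_def PiE_iff mem_Times_iff)
    have "fst (D c) = fst (E c)"
    proof
      fix i show "fst (D c) i = fst (E c) i"
        using *[of i c "[]"] permutes_not_in[OF Dc(1), of i] permutes_not_in[OF Ec(1), of i]
        by (cases "i < count F c") auto
    qed
    moreover have "snd (D c) = snd (E c)"
    proof (rule PiE_ext[OF Dc(2) Ec(2)], rule ext)
      fix i p assume i: "i \<in> {..<count F c}"
      then have "snd (D c) i \<in> Aut c" "snd (E c) i \<in> Aut c"
        using Dc Ec by auto
      then show "snd (D c) i p = snd (E c) i p"
        using * i by (cases "p \<in> vertices c") (auto simp: Aut_iff)
    qed
    ultimately show "D c = E c"
      by (simp add: prod_eq_iff)
  qed
qed

lemma Aut_subset_graft: "Aut (Node d F) \<subseteq> graft F ` graft_data F"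
proof
  fix f assume "f \<in> Aut (Node d F)"
  then have f: "tree_iso (Node d F) (Node d F) f" and out: "\<And>v. v \<notin> vertices (Node d F) \<Longrightarrow> f v = v"
    by (auto simp: Aut_iff)
  define pi where "pi e = hd (f [e])" for e
  define g where "g e p = tl (f (e # p))" for e p
  have bij: "bij_betw pi (slots F) (slots F)"
    and iso: "\<And>e. e \<in> slots F \<Longrightarrow> tree_iso (fst e) (fst (pi e)) (g e)"
    unfolding pi_def g_def by (rule tree_iso_Node[OF f])+
  have fst_pi: "fst (pi e) = fst e" if "e \<in> slots F" for e
    using tree_iso_imp_eq[OF iso[OF that]] by simp
  \<comment> \<open>The data are read off from \<open>f\<close>; since \<open>pi\<close> preserves
    the child, only the index \<open>snd (pi (c, i))\<close> carries information. The defaults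
    \<open>i\<close> and \<open>p\<close> give the identity outside the relevant sets.\<close>
  define D where "D = (\<lambda>c\<in>set_mset F.
    (\<lambda>i. if i < count F c then snd (pi (c, i)) else i,
     \<lambda>i\<in>{..<count F c}. \<lambda>p. if p \<in> vertices c then g (c, i) p else p))"
  have "D \<in> graft_data F"
    unfolding graft_data_def D_def
  proof (intro restrict_PiE_iff[THEN iffD2] ballI SigmaI CollectI)
    fix c assume c: "c \<in># F"
    let ?p = "\<lambda>i. if i < count F c then snd (pi (c, i)) else i"
    have eq: "pi (c, i) = (c, snd (pi (c, i)))" if "i < count F c" for i
      using fst_pi[of "(c, i)"] that by (simp add: prod_eq_iff slots_iff)
    have "?p ` {..<count F c} \<subseteq> {..<count F c}"
    proof (rule image_subsetI)
      fix i assume "i \<in> {..<count F c}"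
      then have i: "i < count F c" by simp
      then have "pi (c, i) \<in> slots F"
        using bij by (auto simp: bij_betw_def slots_iff)
      then show "?p i \<in> {..<count F c}"
        using i eq[OF i] by (simp add: slots_iff) (metis fst_conv)
    qed
    moreover have "inj_on ?p {..<count F c}"
    proof (rule inj_onI)
      fix i j assume "i \<in> {..<count F c}" "j \<in> {..<count F c}" "?p i = ?p j"
      then have ij: "i < count F c" "j < count F c" "pi (c, i) = pi (c, j)"
        using eq[of i] eq[of j] by auto
      then have "(c, i) = (c, j)"
        using bij ij by (auto simp: bij_betw_def slots_iff dest: inj_onD[of pi "slots F"])
      then show "i = j" by simp
    qed
    ultimately have "bij_betw ?p {..<count F c} {..<count F c}"
      unfolding bij_betw_def using endo_inj_surj[OF finite_lessThan] by blast
    then show "?p permutes {..<count F c}"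
      by (rule bij_imp_permutes) simp
    fix i assume "i \<in> {..<count F c}"
    then have "tree_iso c c (g (c, i))"
      using iso[of "(c, i)"] fst_pi[of "(c, i)"] by (simp add: slots_iff)
    then show "(\<lambda>p. if p \<in> vertices c then g (c, i) p else p) \<in> Aut c"
      by (auto simp: Aut_iff tree_iso_def cong: bij_betw_cong)
  qed
  moreover have "f v = graft F D v" for v
  proof (cases "v \<in> vertices (Node d F)")
    case True
    show ?thesis
    proof (cases v)
      case Nil
      then show ?thesis using tree_iso_Nil[OF f] by (simp add: graft_def)
    next
      case (Cons e p)
      with True have e: "e \<in> slots F" "p \<in> vertices (fst e)" by auto
      have "f v = pi e # g e p"
        using tree_iso_hd[OF f, of e p] True by (simp add: Cons pi_def g_def)
      moreover have "pi e = (fst e, snd (pi e))"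
        using fst_pi[OF e(1)] by (simp add: prod_eq_iff)
      ultimately show ?thesis
        using e by (auto simp: Cons graft_def D_def slots_def)
    qed
  next
    case False
    then show ?thesis by (cases v) (auto simp: graft_def out tree_iso_Nil[OF f])
  qed
  ultimately show "f \<in> graft F ` graft_data F"
    by blast
qed

text \<open>\<open>graft\<close> identifies the automorphisms with a product set whose factors are
  counted directly.\<close>

lemma card_Aut_Node:
  "card (Aut (Node d F)) = (\<Prod>c\<in>set_mset F. fact (count F c) * card (Aut c) ^ count F c)"
proof -
  have "Aut (Node d F) = graft F ` graft_data F"
    by (intro subset_antisym image_subsetI Aut_subset_graft graft_in_Aut)
  then have "card (Aut (Node d F)) = card (graft_data F)"
    by (simp add: card_image inj_on_graft)
  also have "\<dots> = (\<Prod>c\<in>set_mset F. fact (count F c) * card (Aut c) ^ count F c)"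
    by (simp add: graft_data_def card_PiE card_cartesian_product card_permutations)
  finally show ?thesis .
qed

subsection \<open>Coefficients of trees and forests\<close>

lemma vtype_simps [simp]:
  "vtype (Node d F) [] = fst d"
  "vtype (Node d F) (e # p) = vtype (fst e) p"
  by (simp_all add: vtype_def)

lemma vweight_simps [simp]:
  "vweight (Node d F) [] = nat_of_posnat (snd d)"
  "vweight (Node d F) (e # p) = vweight (fst e) p"
  by (simp_all add: vweight_def)

definition forest_weight :: "'a dtree multiset \<Rightarrow> nat" where
  "forest_weight F = (\<Sum>t\<in>#F. weight t)"

definition type_count :: "'a dtree multiset \<Rightarrow> 'a \<Rightarrow> nat" where
  "type_count F a = size {#t \<in># F. vtype t [] = a#}"

lemma weight_Node: "weight (Node d F) = nat_of_posnat (snd d) + forest_weight F"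
  by (simp add: weight_def sum_vertices_Node forest_weight_def flip: sum_slots)

lemma od_Node_Nil: "od (Node d F) a [] = type_count F a"
proof -
  have "{u \<in> vertices (Node d F). child_of u [] \<and> vtype (Node d F) u = a}
      = (\<lambda>e. [e]) ` {e \<in> slots F. vtype (fst e) [] = a}"
    (is "?L = ?R")
  proof (rule set_eqI)
    fix u show "u \<in> ?L \<longleftrightarrow> u \<in> ?R"
      by (cases u) auto
  qed
  then have "od (Node d F) a [] = card {e \<in> slots F. vtype (fst e) [] = a}"
    by (simp add: od_def card_image inj_on_def)
  also have "\<dots> = (\<Sum>e\<in>slots F. if vtype (fst e) [] = a then 1 else 0)"
    by (simp add: sum.If_cases Int_def)
  also have "\<dots> = (\<Sum>t\<in>#F. if vtype t [] = a then 1 else 0)"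
    by (rule sum_slots)
  also have "\<dots> = type_count F a"
    by (induction F) (auto simp: type_count_def)
  finally show ?thesis .
qed

lemma od_Node_Cons:
  assumes "e \<in> slots F"
  shows "od (Node d F) a (e # p) = od (fst e) a p"
proof -
  have "{u \<in> vertices (Node d F). child_of u (e # p) \<and> vtype (Node d F) u = a}
      = (#) e ` {u \<in> vertices (fst e). child_of u p \<and> vtype (fst e) u = a}"
    (is "?L = ?R")
  proof (rule set_eqI)
    fix u show "u \<in> ?L \<longleftrightarrow> u \<in> ?R"
      using assms by (cases u) auto
  qed
  then show ?thesis
    by (simp add: od_def card_image)
qed

lemma xi_Node_Cons: "e \<in> slots F \<Longrightarrow> xi s (Node d F) (e # p) = xi s (fst e) p"
  by (simp add: xi_def od_Node_Cons)

text \<open>The exponent of \<open>T\<^sub>b\<close> in \<open>T\<^sub>a Q\<^sup>k\<close>.\<close>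

definition exponent :: "('a \<Rightarrow> 'k::comm_ring_1) \<Rightarrow> 'a \<Rightarrow> nat \<Rightarrow> 'a \<Rightarrow> 'k" where
  "exponent s a k b = of_bool (b = a) + of_nat k * s b"

text \<open>The special factor for the type of the root joins the product over the other types,
  since \<open>exponent\<close> carries the summand 1 exactly there.\<close>

lemma xi_Node_Nil:
  "xi s (Node d F) [] =
     (\<Prod>b\<in>UNIV. falling (exponent s (fst d) (nat_of_posnat (snd d)) b) (type_count F b))"
  by (subst prod.remove[of _ "fst d"])
     (auto simp: xi_def od_Node_Nil exponent_def mult.commute intro!: prod.cong)

definition tree_coeff :: "('a::finite \<Rightarrow> 'k::comm_rat_algebra) \<Rightarrow> 'a dtree \<Rightarrow> 'k" where
  "tree_coeff s t = (\<Prod>v\<in>vertices t. xi s t v) * rat_map (1 / of_nat (card (Aut t)))"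

text \<open>This is \<open>W(F)\<close>: the coefficient of \<open>F\<close> in the formal
  exponential of the sum of all trees \<open>t\<close> weighted by
  \<open>tree_coeff s t\<close>.\<close>

definition forest_coeff :: "('a::finite \<Rightarrow> 'k::comm_rat_algebra) \<Rightarrow> 'a dtree multiset \<Rightarrow> 'k" where
  "forest_coeff s F = (\<Prod>t\<in>set_mset F. tree_coeff s t ^ count F t * rat_map (1 / fact (count F t)))"

lemma rat_map_0 [simp]: "rat_map 0 = 0"
  using rat_map_add[of 0 0] by simp

lemma rat_map_of_nat [simp]: "rat_map (of_nat n) = of_nat n"
  by (induction n) (simp_all add: rat_map_add rat_map_one)

lemma rat_map_prod: "rat_map (\<Prod>x\<in>A. f x) = (\<Prod>x\<in>A. rat_map (f x))"
  by (induction A rule: infinite_finite_induct) (simp_all add: rat_map_mult rat_map_one)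

lemma rat_map_power: "rat_map (x ^ n) = rat_map x ^ n"
  by (induction n) (simp_all add: rat_map_mult rat_map_one)

text \<open>Below the root, \<open>xi\<close> agrees with its value in the child subtree, so its
  product is multiplicative over the copies of the children. Dividing by
  \<open>card_Aut_Node\<close> then yields the factors of \<open>forest_coeff\<close>.\<close>

lemma tree_coeff_Node:
  fixes s :: "'a::finite \<Rightarrow> 'k::comm_rat_algebra"
  shows "tree_coeff s (Node d F) =
     (\<Prod>b\<in>UNIV. falling (exponent s (fst d) (nat_of_posnat (snd d)) b) (type_count F b)) *
     forest_coeff s F"
proof -
  have "(\<Prod>v\<in>vertices (Node d F). xi s (Node d F) v)
      = xi s (Node d F) [] * (\<Prod>e\<in>slots F. \<Prod>p\<in>vertices (fst e). xi s (fst e) p)"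
    by (simp add: prod_vertices_Node xi_Node_Cons)
  also have "(\<Prod>e\<in>slots F. \<Prod>p\<in>vertices (fst e). xi s (fst e) p)
      = (\<Prod>t\<in>set_mset F. (\<Prod>p\<in>vertices t. xi s t p) ^ count F t)"
    by (simp add: prod_slots[of "\<lambda>t. \<Prod>p\<in>vertices t. xi s t p"] image_prod_mset_multiplicity)
  moreover have "rat_map (1 / of_nat (card (Aut (Node d F))) :: rat)
      = (\<Prod>t\<in>set_mset F. rat_map (1 / of_nat (card (Aut t))) ^ count F t * rat_map (1 / fact (count F t)) :: 'k)"
  proof -
    have "1 / of_nat (card (Aut (Node d F))) =
        (\<Prod>t\<in>set_mset F. (1 / of_nat (card (Aut t))) ^ count F t * (1 / fact (count F t)) :: rat)"
      by (simp add: card_Aut_Node prod_dividef power_one_over mult.commute)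
    then show ?thesis
      by (simp only: rat_map_prod rat_map_power rat_map_mult)
  qed
  ultimately show ?thesis
    by (simp add: tree_coeff_def forest_coeff_def xi_Node_Nil prod.distrib power_mult_distrib mult_ac)
qed

subsection \<open>Scalar powers of series\<close>

lemma finite_subset_mset: "finite {X. X \<subseteq># F}"
proof (rule finite_subset)
  show "{X. X \<subseteq># F} \<subseteq> (\<Union>n\<le>size F. multisets_of_size (set_mset F) n)"
    by (auto simp: multisets_of_size_def dest: set_mset_mono size_mset_mono)
qed auto

text \<open>Multisets are cancellative, so a factorisation of \<open>F\<close> is determined by its
  first factor \<open>X\<close>, and the inner convolution sum has at most one nonzero term.\<close>

lemma lookup_mult_multiset:
  fixes f g :: "'b multiset \<Rightarrow>\<^sub>0 'k::comm_semiring_0"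
  shows "Poly_Mapping.lookup (f * g) F =
    (\<Sum>X | X \<subseteq># F. Poly_Mapping.lookup f X * Poly_Mapping.lookup g (F - X))"
proof -
  have inner: "(\<Sum>q. Poly_Mapping.lookup g q when F = X + q)
      = (Poly_Mapping.lookup g (F - X) when X \<subseteq># F)" for X
  proof (cases "X \<subseteq># F")
    case True
    then have "F = X + q \<longleftrightarrow> q = F - X" for q
      by auto
    then show ?thesis using True by simp
  next
    case False
    then have "F \<noteq> X + q" for q by auto
    then show ?thesis using False by simp
  qed
  show ?thesis
    unfolding lookup_mult inner
    by (subst Sum_any.expand_superset[OF finite_subset_mset[of F]])
       (auto simp: when_def intro!: sum.cong split: if_splits)
qed

lemma lookup_scalar_mult:
  fixes h :: "('d, 'k::comm_semiring_0) H"
  shows "Poly_Mapping.lookup (scalar c * h) F = c * Poly_Mapping.lookup h F"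
proof -
  have "Poly_Mapping.lookup (scalar c * h) F =
      (\<Sum>X | X \<subseteq># F. if X = {#} then c * Poly_Mapping.lookup h F else 0)"
    unfolding lookup_mult_multiset scalar_def
    by (intro sum.cong) (auto simp: lookup_single when_def)
  then show ?thesis
    by (simp add: finite_subset_mset)
qed

lemma scalar_add: "scalar (a + b) = scalar a + scalar b"
  by (simp add: scalar_def single_add)

lemma scalar_mult: "scalar (a * b :: 'k::comm_semiring_0) = scalar a * scalar b"
  by (simp add: scalar_def mult_single)

lemma scalar_0 [simp]: "scalar 0 = 0"
  by (simp add: scalar_def)

lemma scalar_1 [simp]: "scalar (1 :: 'k::comm_semiring_1) = 1"
  by (simp add: scalar_def flip: single_one)

lemma scalar_sum: "scalar (\<Sum>x\<in>A. f x) = (\<Sum>x\<in>A. scalar (f x))"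
  by (induction A rule: infinite_finite_induct) (simp_all add: scalar_add)

lemma lookup_B_plus:
  "Poly_Mapping.lookup (B_plus d h) {#Node d F#} = Poly_Mapping.lookup h F"
proof -
  have "Poly_Mapping.lookup (B_plus d h) {#Node d F#} =
      (\<Sum>F'\<in>Poly_Mapping.keys h. if F' = F then Poly_Mapping.lookup h F else 0)"
    unfolding B_plus_def lookup_sum
    by (intro sum.cong) (auto simp: lookup_single when_def)
  then show ?thesis
    by (simp add: in_keys_iff)
qed

lemma lookup_B_plus_0:
  assumes "\<And>F. G \<noteq> {#Node d F#}"
  shows "Poly_Mapping.lookup (B_plus d h) G = 0"
proof -
  have "{#Node d F#} \<noteq> G" for F
    using assms[of F] by blast
  then show ?thesis
    unfolding B_plus_def lookup_sum by (simp add: lookup_single)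
qed

section \<open>Composition of series\<close>

text \<open>Commutative rings are the right generality because \<open>H\<close> over an arbitrary
  \<open>K\<close> can have zero divisors. Both sides expand into the products of coefficients
  \<open>i\<close> of \<open>a\<close> and \<open>j\<close> of \<open>b\<close> with
  \<open>c ^ (i + j)\<close>.\<close>

lemma fps_compose_mult_distrib_comm_ring:
  fixes a b c :: "'r::comm_ring_1 fps"
  assumes c0: "fps_nth c 0 = 0"
  shows "(a * b) oo c = (a oo c) * (b oo c)"
proof (rule fps_ext)
  fix n
  have low: "fps_nth (c ^ i) m = 0" if "m < i" for i m
    using startsby_zero_power_prefix[OF c0] that by blast
  \<comment> \<open>A bound \<open>n\<close> independent of \<open>m\<close> makes the index ranges
    rectangular, so that the sums may be swapped.\<close>
  have ext: "fps_nth (f oo c) m = (\<Sum>i\<le>n. fps_nth f i * fps_nth (c ^ i) m)" if "m \<le> n" for f m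
    unfolding fps_compose_nth atLeast0AtMost
    using that by (intro sum.mono_neutral_left) (auto simp: low)
  have "fps_nth ((a oo c) * (b oo c)) n
      = (\<Sum>m\<le>n. (\<Sum>i\<le>n. fps_nth a i * fps_nth (c ^ i) m) * (\<Sum>j\<le>n. fps_nth b j * fps_nth (c ^ j) (n - m)))"
    by (simp add: fps_mult_nth atLeast0AtMost ext)
  also have "\<dots> = (\<Sum>m\<le>n. \<Sum>i\<le>n. \<Sum>j\<le>n. fps_nth a i * fps_nth b j * (fps_nth (c ^ i) m * fps_nth (c ^ j) (n - m)))"
    by (simp add: sum_product mult_ac)
  also have "\<dots> = (\<Sum>i\<le>n. \<Sum>m\<le>n. \<Sum>j\<le>n. fps_nth a i * fps_nth b j * (fps_nth (c ^ i) m * fps_nth (c ^ j) (n - m)))"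
    by (rule sum.swap)
  also have "\<dots> = (\<Sum>i\<le>n. \<Sum>j\<le>n. \<Sum>m\<le>n. fps_nth a i * fps_nth b j * (fps_nth (c ^ i) m * fps_nth (c ^ j) (n - m)))"
    by (rule sum.cong[OF refl]) (rule sum.swap)
  also have "\<dots> = (\<Sum>i\<le>n. \<Sum>j\<le>n. fps_nth a i * fps_nth b j * fps_nth (c ^ (i + j)) n)"
    by (simp add: power_add fps_mult_nth sum_distrib_left atLeast0AtMost)
  also have "\<dots> = (\<Sum>(i, j)\<in>{..n} \<times> {..n}. fps_nth a i * fps_nth b j * fps_nth (c ^ (i + j)) n)"
    by (simp add: sum.cartesian_product)
  \<comment> \<open>For \<open>i + j > n\<close> the power \<open>c ^ (i + j)\<close> has no term of
    degree \<open>n\<close>; the remaining triangle is then summed along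
    \<open>k = i + j\<close>.\<close>
  also have "\<dots> = (\<Sum>(i, j)\<in>{(i, j). i + j \<le> n}. fps_nth a i * fps_nth b j * fps_nth (c ^ (i + j)) n)"
    by (rule sum.mono_neutral_right) (auto, metis low not_le mult_zero_right)
  also have "\<dots> = (\<Sum>k\<le>n. \<Sum>i\<le>k. fps_nth a i * fps_nth b (k - i) * fps_nth (c ^ k) n)"
    by (subst sum.triangle_reindex_eq) simp
  also have "\<dots> = fps_nth ((a * b) oo c) n"
    by (simp add: fps_compose_nth fps_mult_nth sum_distrib_right atLeast0AtMost)
  finally show "fps_nth ((a * b) oo c) n = fps_nth ((a oo c) * (b oo c)) n" ..
qed

section \<open>Falling factorials and the binomial series\<close>

lemma falling_eq_pochhammer: "falling y n = (- 1) ^ n * pochhammer (- y) n"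
proof (induction n)
  case (Suc n)
  have "falling y (Suc n) = falling y n * (y - of_nat n)"
    by (simp add: falling_def)
  also have "\<dots> = (- 1) ^ Suc n * (pochhammer (- y) n * (- y + of_nat n))"
    unfolding Suc.IH by (simp add: algebra_simps)
  finally show ?case
    by (simp only: pochhammer_Suc)
qed (simp add: falling_def)

text \<open>The Chu-Vandermonde identity, obtained from its rising form at \<open>- p\<close> and
  \<open>- q\<close>.\<close>

lemma falling_add:
  "falling (p + q) n = (\<Sum>k\<le>n. of_nat (n choose k) * falling p k * falling q (n - k))"
proof -
  have "falling (p + q) n = (- 1) ^ n * pochhammer (- p + - q) n"
    by (simp add: falling_eq_pochhammer)
  also have "\<dots> = (\<Sum>k\<le>n. (- 1) ^ n * (of_nat (n choose k) * pochhammer (- p) k * pochhammer (- q) (n - k)))"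
    by (simp only: pochhammer_binomial_sum sum_distrib_left)
  also have "\<dots> = (\<Sum>k\<le>n. of_nat (n choose k) * falling p k * falling q (n - k))"
  proof (rule sum.cong[OF refl])
    fix k assume "k \<in> {..n}"
    then have "(- 1 :: 'a) ^ n = (- 1) ^ k * (- 1) ^ (n - k)"
      by (simp flip: power_add)
    then show "(- 1) ^ n * (of_nat (n choose k) * pochhammer (- p) k * pochhammer (- q) (n - k))
        = of_nat (n choose k) * falling p k * falling q (n - k)"
      by (simp add: falling_eq_pochhammer mult_ac)
  qed
  finally show ?thesis .
qed

lemma falling_0: "falling 0 n = of_bool (n = 0)"
  by (auto simp: falling_def intro!: prod_zero bexI[of _ 0])

lemma falling_1: "falling 1 n = of_bool (n \<le> 1)"
proof (cases "n \<le> 1")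
  case True
  then consider "n = 0" | "n = 1" by linarith
  then show ?thesis by cases (auto simp: falling_def)
next
  case False
  then show ?thesis by (auto simp: falling_def intro!: prod_zero bexI[of _ 1])
qed

text \<open>Dividing Chu-Vandermonde by \<open>fact n\<close> turns it into the Cauchy product of
  the two series.\<close>

lemma binomial_series_add:
  fixes p q :: "'k::comm_rat_algebra"
  shows "binomial_series (p + q) = binomial_series p * binomial_series q"
proof (rule fps_ext)
  fix n
  have "(1 / fact n :: rat) * of_nat (n choose k) = (1 / fact k) * (1 / fact (n - k))" if "k \<le> n" for k
    using binomial_fact_lemma[OF that, THEN arg_cong[of _ _ "of_nat :: nat \<Rightarrow> rat"]]
    by (simp add: field_simps)
  \<comment> \<open>\<open>K\<close> need not have division, so the identity is proved over the
    rationals and transported by \<open>rat_map\<close>.\<close>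
  then have *: "rat_map (1 / fact n) * of_nat (n choose k) = (rat_map (1 / fact k) * rat_map (1 / fact (n - k)) :: 'k)" if "k \<le> n" for k
    using that by (metis rat_map_mult rat_map_of_nat)
  have "rat_map (1 / fact n) * falling (p + q) n =
    (\<Sum>k\<le>n. (rat_map (1 / fact k) * falling p k) * (rat_map (1 / fact (n - k)) * falling q (n - k)))"
    unfolding falling_add sum_distrib_left
  proof (rule sum.cong[OF refl])
    fix k assume "k \<in> {..n}"
    then show "rat_map (1 / fact n) * (of_nat (n choose k) * falling p k * falling q (n - k)) =
      (rat_map (1 / fact k) * falling p k) * (rat_map (1 / fact (n - k)) * falling q (n - k))"
      using arg_cong[OF *[of k], of "\<lambda>x. x * (falling p k * falling q (n - k))"]
      by (simp add: mult_ac)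
  qed
  then show "fps_nth (binomial_series (p + q)) n = fps_nth (binomial_series p * binomial_series q) n"
    by (simp add: binomial_series_def fps_mult_nth atLeast0AtMost scalar_sum flip: scalar_mult)
qed

lemma fps_scalar_power_add:
  assumes "fps_nth T 0 = 1"
  shows "fps_scalar_power T (p + q) = fps_scalar_power T p * fps_scalar_power T q"
  using assms
  by (simp add: fps_scalar_power_def binomial_series_add fps_compose_mult_distrib_comm_ring)

lemma fps_scalar_power_0:
  fixes T :: "('d, 'k::comm_rat_algebra) H fps"
  shows "fps_scalar_power T 0 = 1"
proof -
  have "binomial_series 0 = (1 :: ('d, 'k) H fps)"
    by (rule fps_ext) (simp add: binomial_series_def falling_0 rat_map_one)
  then show ?thesis
    by (simp add: fps_scalar_power_def)
qed

lemma fps_scalar_power_1: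
  fixes T :: "('d, 'k::comm_rat_algebra) H fps"
  assumes "fps_nth T 0 = 1"
  shows "fps_scalar_power T 1 = T"
proof -
  have "binomial_series 1 = (1 + fps_X :: ('d, 'k) H fps)"
    by (rule fps_ext) (auto simp: binomial_series_def falling_1 rat_map_one fps_X_def)
  then show ?thesis
    using assms by (simp add: fps_scalar_power_def fps_compose_add_distrib)
qed

lemma fps_scalar_power_of_nat_mult:
  assumes "fps_nth T 0 = 1"
  shows "fps_scalar_power T (of_nat k * p) = fps_scalar_power T p ^ k"
  by (induction k) (simp_all add: fps_scalar_power_0 fps_scalar_power_add[OF assms] distrib_right)

text \<open>The extra factor \<open>T a\<close> is absorbed as a power with exponent
  \<open>of_bool (b = a)\<close>, which leaves a single product of scalar powers to expand.\<close>

lemma mult_Q_series_power: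
  assumes "\<And>a. fps_nth (T a) 0 = 1"
  shows "T a * Q_series s T ^ k = (\<Prod>b\<in>UNIV. fps_scalar_power (T b) (exponent s a k b))"
proof -
  have "(\<Prod>b\<in>UNIV. fps_scalar_power (T b) (exponent s a k b))
      = (\<Prod>b\<in>UNIV. fps_scalar_power (T b) (of_bool (b = a))) * Q_series s T ^ k"
    by (simp add: exponent_def fps_scalar_power_add assms fps_scalar_power_of_nat_mult
        prod.distrib Q_series_def prod_power_distrib)
  also have "(\<Prod>b\<in>UNIV. fps_scalar_power (T b) (of_bool (b = a))) = (\<Prod>b\<in>UNIV. if b = a then T b else 1)"
    by (intro prod.cong) (auto simp: fps_scalar_power_0 fps_scalar_power_1 assms)
  finally show ?thesis by simp
qed

subsection \<open>Finiteness\<close>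

lemma forest_weight_simps [simp]:
  "forest_weight {#} = 0"
  "forest_weight (add_mset t F) = weight t + forest_weight F"
  "forest_weight (F + G) = forest_weight F + forest_weight G"
  by (simp_all add: forest_weight_def)

lemma nat_of_posnat_ge_1: "1 \<le> nat_of_posnat k"
  using nat_of_posnat[of k] by simp

lemma weight_pos: "1 \<le> weight t"
  using nat_of_posnat_ge_1 by (cases t) (simp add: weight_Node trans_le_add1)

lemma weight_neq_0 [simp]: "weight t \<noteq> 0"
  using weight_pos[of t] by simp

lemma size_le_forest_weight: "size F \<le> forest_weight F"
proof (induction F)
  case (add t F)
  then show ?case using weight_pos[of t] by simp
qed simp

lemma weight_le_forest_weight: "t \<in># F \<Longrightarrow> weight t \<le> forest_weight F"
  by (metis forest_weight_simps(2) insert_DiffM le_add1)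

lemma finite_posnat_le: "finite {k. nat_of_posnat k \<le> n}"
proof (rule finite_subset)
  show "{k. nat_of_posnat k \<le> n} \<subseteq> posnat_of_nat ` {..n}"
    by (metis (mono_tags, lifting) atMost_iff image_eqI mem_Collect_eq nat_of_posnat_inverse subsetI)
qed simp

text \<open>The root has weight at least 1, so for bound \<open>Suc n\<close> the children form a
  forest of weight at most \<open>n\<close>: at most \<open>n\<close> trees, each covered by the
  induction hypothesis. The root has finitely many possible decorations.\<close>

lemma finite_weight_le: "finite {t :: 'a::finite dtree. weight t \<le> n}"
proof (induction n)
  case 0
  show ?case by simp
next
  case (Suc n)
  let ?Fs = "\<Union>m\<le>n. multisets_of_size {t :: 'a dtree. weight t \<le> n} m"
  have "{t :: 'a dtree. weight t \<le> Suc n} \<subseteq>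
      (\<lambda>(d, F). Node d F) ` ((UNIV \<times> {k. nat_of_posnat k \<le> Suc n}) \<times> ?Fs)"
  proof
    fix t :: "'a dtree" assume t: "t \<in> {t. weight t \<le> Suc n}"
    obtain a k F where Node: "t = Node (a, k) F"
      by (metis rtree.exhaust surj_pair)
    then have w: "nat_of_posnat k + forest_weight F \<le> Suc n"
      using t by (simp add: weight_Node)
    then have F: "forest_weight F \<le> n"
      using nat_of_posnat_ge_1[of k] by linarith
    then have "F \<in> ?Fs"
      using size_le_forest_weight[of F] weight_le_forest_weight[of _ F]
      by (auto simp: multisets_of_size_def) (meson le_trans)+
    then show "t \<in> (\<lambda>(d, F). Node d F) ` ((UNIV \<times> {k. nat_of_posnat k \<le> Suc n}) \<times> ?Fs)"
      using w Node by (auto simp: image_iff)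
  qed
  moreover have "finite ((UNIV \<times> {k. nat_of_posnat k \<le> Suc n}) \<times> ?Fs :: (('a \<times> posnat) \<times> 'a dtree multiset) set)"
    using Suc finite_posnat_le by (intro finite_cartesian_product finite_UN_I finite_multisets_of_size) auto
  ultimately show ?case
    by (meson finite_imageI finite_subset)
qed

lemma finite_weight_eq: "finite {t :: 'a::finite dtree. P t \<and> weight t = n}"
  by (rule finite_subset[OF _ finite_weight_le[of n]]) auto

subsection \<open>Forest expansions\<close>

text \<open>The coefficient of degree \<open>n\<close> is supported on forests of weight
  \<open>n\<close>, so a single function on forests records the whole series.\<close>

definition graded :: "('a \<times> posnat, 'k::zero) H fps \<Rightarrow> ('a dtree multiset \<Rightarrow> 'k) \<Rightarrow> bool" where
  "graded h g \<longleftrightarrow> (\<forall>n F. Poly_Mapping.lookup (fps_nth h n) F = (if forest_weight F = n then g F else 0))"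

lemma graded_cong: "graded h g \<Longrightarrow> (\<And>F. g F = g' F) \<Longrightarrow> graded h g'"
  by (simp add: graded_def)

lemma graded_one: "graded (1 :: ('a \<times> posnat, 'k::comm_semiring_1) H fps) (\<lambda>F. of_bool (F = {#}))"
  by (auto simp: graded_def fps_one_nth lookup_one when_def)

text \<open>Weight is additive over \<open>X\<close> and \<open>F - X\<close>, so the Cauchy product
  contributes only at \<open>i = forest_weight X\<close>.\<close>

lemma graded_mult:
  fixes f h :: "('a \<times> posnat, 'k::comm_semiring_1) H fps"
  assumes "graded f g" "graded h g'"
  shows "graded (f * h) (\<lambda>F. \<Sum>X | X \<subseteq># F. g X * g' (F - X))"
  unfolding graded_def
proof (intro allI)
  fix n F
  have "Poly_Mapping.lookup (fps_nth (f * h) n) F =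
      (\<Sum>i\<le>n. \<Sum>X | X \<subseteq># F. Poly_Mapping.lookup (fps_nth f i) X * Poly_Mapping.lookup (fps_nth h (n - i)) (F - X))"
    by (simp add: fps_mult_nth lookup_sum lookup_mult_multiset atLeast0AtMost)
  also have "\<dots> = (\<Sum>X | X \<subseteq># F. \<Sum>i\<le>n. Poly_Mapping.lookup (fps_nth f i) X * Poly_Mapping.lookup (fps_nth h (n - i)) (F - X))"
    by (rule sum.swap)
  also have "\<dots> = (\<Sum>X | X \<subseteq># F. if forest_weight F = n then g X * g' (F - X) else 0)"
  proof (rule sum.cong[OF refl])
    fix X assume "X \<in> {X. X \<subseteq># F}"
    then have w: "forest_weight F = forest_weight X + forest_weight (F - X)"
      by (metis forest_weight_simps(3) mem_Collect_eq subset_mset.add_diff_inverse)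
    have "(\<Sum>i\<le>n. Poly_Mapping.lookup (fps_nth f i) X * Poly_Mapping.lookup (fps_nth h (n - i)) (F - X))
      = (\<Sum>i\<le>n. if i = forest_weight X then (if forest_weight F = n then g X * g' (F - X) else 0) else 0)"
      using assms w by (intro sum.cong) (auto simp: graded_def)
    also have "\<dots> = (if forest_weight F = n then g X * g' (F - X) else 0)"
      using w by auto
    finally show "(\<Sum>i\<le>n. Poly_Mapping.lookup (fps_nth f i) X * Poly_Mapping.lookup (fps_nth h (n - i)) (F - X))
      = (if forest_weight F = n then g X * g' (F - X) else 0)" .
  qed
  finally show "Poly_Mapping.lookup (fps_nth (f * h) n) F =
      (if forest_weight F = n then \<Sum>X | X \<subseteq># F. g X * g' (F - X) else 0)"
    by simp
qed

section \<open>Calculus of forest coefficients\<close>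

lemma forest_coeff_superset:
  assumes "finite A" "set_mset F \<subseteq> A"
  shows "forest_coeff s F = (\<Prod>t\<in>A. tree_coeff s t ^ count F t * rat_map (1 / fact (count F t)))"
  unfolding forest_coeff_def using assms
  by (intro prod.mono_neutral_left) (auto simp: not_in_iff rat_map_one)

lemma forest_coeff_simps [simp]:
  "forest_coeff s {#} = 1"
  "forest_coeff s {#t#} = tree_coeff s t"
  by (simp_all add: forest_coeff_def rat_map_one)

lemma forest_coeff_add:
  assumes "set_mset F \<inter> set_mset G = {}"
  shows "forest_coeff s (F + G) = forest_coeff s F * forest_coeff s G"
proof -
  have zero: "t \<in># F \<Longrightarrow> count G t = 0" "t \<in># G \<Longrightarrow> count F t = 0" for t
    using assms by (auto simp: disjoint_iff not_in_iff[symmetric])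
  have "forest_coeff s (F + G) =
      (\<Prod>t\<in>set_mset F. tree_coeff s t ^ count (F + G) t * rat_map (1 / fact (count (F + G) t))) *
      (\<Prod>t\<in>set_mset G. tree_coeff s t ^ count (F + G) t * rat_map (1 / fact (count (F + G) t)))"
    unfolding forest_coeff_def set_mset_union using assms by (intro prod.union_disjoint) auto
  also have "\<dots> = forest_coeff s F * forest_coeff s G"
    unfolding forest_coeff_def using zero
    by (intro arg_cong2[of _ _ _ _ "(*)"] prod.cong) auto
  finally show ?thesis .
qed

lemma of_nat_mult_rat_map_fact:
  "of_nat (Suc n) * rat_map (1 / fact (Suc n)) = rat_map (1 / fact n)"
proof -
  have "of_nat (Suc n) * (1 / fact (Suc n)) = (1 / fact n :: rat)"
    by (simp del: of_nat_Suc)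
  then show ?thesis
    by (metis rat_map_mult rat_map_of_nat)
qed

lemma rat_map_fact_mult: "rat_map (1 / fact n) * of_nat (fact n) = 1"
proof -
  have "(1 / fact n) * of_nat (fact n) = (1 :: rat)"
    by simp
  then show ?thesis
    by (metis rat_map_mult rat_map_of_nat rat_map_one)
qed

text \<open>Only the factor of \<open>t\<close> changes: with \<open>m\<close> copies,
  \<open>c^m / m!\<close> becomes \<open>c^(m-1) / (m-1)!\<close>, and multiplying by
  \<open>c\<close> gives \<open>m\<close> times the old factor.\<close>

lemma forest_coeff_remove:
  assumes "t \<in># F"
  shows "tree_coeff s t * forest_coeff s (F - {#t#}) = of_nat (count F t) * forest_coeff s F"
proof -
  let ?g = "\<lambda>F t. tree_coeff s t ^ count F t * rat_map (1 / fact (count F t))"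
  obtain n where n: "count F t = Suc n"
    using assms by (metis count_greater_zero_iff gr0_implies_Suc)
  have 1: "forest_coeff s (F - {#t#}) = ?g (F - {#t#}) t * (\<Prod>u\<in>set_mset F - {t}. ?g (F - {#t#}) u)"
    using assms by (subst forest_coeff_superset[of "set_mset F"])
      (auto dest: in_diffD simp: prod.remove[of _ t])
  have 2: "forest_coeff s F = ?g F t * (\<Prod>u\<in>set_mset F - {t}. ?g F u)"
    using assms by (simp add: forest_coeff_def prod.remove[of _ t])
  have 3: "(\<Prod>u\<in>set_mset F - {t}. ?g (F - {#t#}) u) = (\<Prod>u\<in>set_mset F - {t}. ?g F u)"
    by (intro prod.cong) auto
  have 4: "tree_coeff s t * ?g (F - {#t#}) t = of_nat (count F t) * ?g F t"
    by (simp add: n of_nat_mult_rat_map_fact[of n, symmetric] mult_ac del: of_nat_Suc fact_Suc)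
  show ?thesis
    unfolding 1 2 3 using 4 by (simp add: mult.assoc[symmetric])
qed

section \<open>Powers of the tree series\<close>

definition tree_series ::
    "('a::finite \<Rightarrow> 'k::comm_rat_algebra) \<Rightarrow> 'a \<Rightarrow> ('a \<times> posnat, 'k) H fps" where
  "tree_series s b = Abs_fps (\<lambda>n. \<Sum>t | vtype t [] = b \<and> weight t = n.
     Poly_Mapping.single {#t#} (tree_coeff s t))"

definition types_in :: "'a set \<Rightarrow> 'a dtree multiset \<Rightarrow> bool" where
  "types_in B F \<longleftrightarrow> (\<forall>t\<in>#F. vtype t [] \<in> B)"

lemma types_in_diff:
  assumes "X \<subseteq># F"
  shows "types_in B F \<longleftrightarrow> types_in B X \<and> types_in B (F - X)"
proof -
  have "set_mset F = set_mset X \<union> set_mset (F - X)"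
    using assms by (metis set_mset_union subset_mset.add_diff_inverse)
  then show ?thesis
    by (auto simp: types_in_def)
qed

lemma tree_series_nth_0: "fps_nth (tree_series s b) 0 = 0"
  by (simp add: tree_series_def)

lemma graded_tree_series:
  "graded (tree_series s b) (\<lambda>F. if size F = 1 \<and> types_in {b} F then forest_coeff s F else 0)"
  unfolding graded_def
proof (intro allI)
  fix n and F :: "'a dtree multiset"
  have *: "Poly_Mapping.lookup (fps_nth (tree_series s b) n) F =
      (\<Sum>t | vtype t [] = b \<and> weight t = n. if F = {#t#} then tree_coeff s t else 0)"
    by (auto simp: tree_series_def lookup_sum lookup_single when_def intro!: sum.cong)
  show "Poly_Mapping.lookup (fps_nth (tree_series s b) n) F = (if forest_weight F = n then
      if size F = 1 \<and> types_in {b} F then forest_coeff s F else 0 else 0)"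
  proof (cases "size F = 1")
    case True
    then obtain u where u: "F = {#u#}"
      using size_1_singleton_mset by blast
    show ?thesis
      unfolding * by (simp add: u types_in_def finite_weight_eq)
  next
    case False
    then show ?thesis
      unfolding * by (auto intro!: sum.neutral)
  qed
qed

text \<open>Splitting one tree \<open>t\<close> off \<open>F\<close> contributes
  \<open>count F t\<close> times \<open>n! W(F)\<close> by \<open>forest_coeff_remove\<close>; the
  multiplicities sum to \<open>size F = Suc n\<close>, which completes the factorial.\<close>

lemma graded_tree_series_power:
  "graded (tree_series s b ^ n)
     (\<lambda>F. if size F = n \<and> types_in {b} F then of_nat (fact n) * forest_coeff s F else 0)"
proof (induction n)
  case 0
  show ?case
    unfolding power_0 by (rule graded_cong[OF graded_one]) (auto simp: types_in_def)
next
  case (Suc n)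
  let ?g = "\<lambda>X. if size X = 1 \<and> types_in {b} X then forest_coeff s X else 0"
  let ?h = "\<lambda>X. if size X = n \<and> types_in {b} X then of_nat (fact n) * forest_coeff s X else 0"
  show ?case
    unfolding power_Suc
  proof (rule graded_cong[OF graded_mult[OF graded_tree_series Suc.IH]])
    fix F :: "'a dtree multiset"
    show "(\<Sum>X | X \<subseteq># F. ?g X * ?h (F - X)) =
        (if size F = Suc n \<and> types_in {b} F then of_nat (fact (Suc n)) * forest_coeff s F else 0)"
    proof (cases "size F = Suc n \<and> types_in {b} F")
      case True
      have "(\<Sum>X | X \<subseteq># F. ?g X * ?h (F - X)) = (\<Sum>X\<in>(\<lambda>t. {#t#}) ` set_mset F. ?g X * ?h (F - X))"
        using size_1_singleton_mset by (intro sum.mono_neutral_right finite_subset_mset) fastforce+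
      also have "\<dots> = (\<Sum>t\<in>set_mset F. tree_coeff s t * (of_nat (fact n) * forest_coeff s (F - {#t#})))"
      proof (subst sum.reindex)
        show "sum ((\<lambda>X. ?g X * ?h (F - X)) \<circ> (\<lambda>t. {#t#})) (set_mset F)
            = (\<Sum>t\<in>set_mset F. tree_coeff s t * (of_nat (fact n) * forest_coeff s (F - {#t#})))"
        proof (rule sum.cong[OF refl])
          fix t assume "t \<in># F"
          then have "{#t#} \<subseteq># F" "size (F - {#t#}) = n"
            using True by (simp_all add: size_Diff_singleton)
          then show "((\<lambda>X. ?g X * ?h (F - X)) \<circ> (\<lambda>t. {#t#})) t
              = tree_coeff s t * (of_nat (fact n) * forest_coeff s (F - {#t#}))"
            using True types_in_diff[of "{#t#}" F] by simp
        qed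
      qed (simp add: inj_on_def)
      also have "\<dots> = (\<Sum>t\<in>set_mset F. of_nat (count F t) * (of_nat (fact n) * forest_coeff s F))"
        by (rule sum.cong[OF refl]) (metis forest_coeff_remove mult.left_commute)
      also have "\<dots> = of_nat (size F) * (of_nat (fact n) * forest_coeff s F)"
        by (simp add: size_multiset_overloaded_eq sum_distrib_right)
      finally show ?thesis
        using True by (simp add: algebra_simps)
    next
      case False
      have "?g X * ?h (F - X) = 0" if "X \<subseteq># F" for X
      proof -
        have "size F = size X + size (F - X)"
          using that by (metis size_union subset_mset.add_diff_inverse)
        then show ?thesis
          using False types_in_diff[OF that, of "{b}"] by auto
      qed
      then have "(\<Sum>X | X \<subseteq># F. ?g X * ?h (F - X)) = 0"
        by (intro sum.neutral) blast
      then show ?thesis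
        unfolding if_not_P[OF False] .
    qed
  qed
qed

text \<open>The \<open>i\<close>-th power sees only forests of size \<open>i\<close>, and its factor
  \<open>fact i\<close> cancels the denominator of the binomial series.\<close>

lemma graded_scalar_power:
  "graded (fps_scalar_power (1 + tree_series s b) p)
     (\<lambda>F. if types_in {b} F then falling p (size F) * forest_coeff s F else 0)"
  unfolding graded_def
proof (intro allI)
  fix n and F :: "'a dtree multiset"
  have "Poly_Mapping.lookup (fps_nth (fps_scalar_power (1 + tree_series s b) p) n) F
     = (\<Sum>i\<le>n. rat_map (1 / fact i) * falling p i * Poly_Mapping.lookup (fps_nth (tree_series s b ^ i) n) F)"
    by (simp add: fps_scalar_power_def fps_compose_nth lookup_sum lookup_scalar_mult
        binomial_series_def atLeast0AtMost)
  also have "\<dots> = (\<Sum>i\<le>n. if i = size F then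
      if forest_weight F = n \<and> types_in {b} F then falling p (size F) * forest_coeff s F else 0 else 0)"
  proof (rule sum.cong[OF refl])
    fix i
    have "rat_map (1 / fact i) * falling p i * (of_nat (fact i) * forest_coeff s F) = falling p i * forest_coeff s F"
      by (metis (no_types, lifting) rat_map_fact_mult mult.assoc mult.left_commute mult_1)
    then show "rat_map (1 / fact i) * falling p i * Poly_Mapping.lookup (fps_nth (tree_series s b ^ i) n) F =
      (if i = size F then
      if forest_weight F = n \<and> types_in {b} F then falling p (size F) * forest_coeff s F else 0 else 0)"
      using graded_tree_series_power[of s b i] by (auto simp: graded_def)
  qed
  \<comment> \<open>The index \<open>size F\<close> lies in the range of summation because every
    tree has weight at least 1.\<close>
  also have "\<dots> = (if forest_weight F = n then
      if types_in {b} F then falling p (size F) * forest_coeff s F else 0 else 0)"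
    using size_le_forest_weight[of F] by auto
  finally show "Poly_Mapping.lookup (fps_nth (fps_scalar_power (1 + tree_series s b) p) n) F =
     (if forest_weight F = n then
      if types_in {b} F then falling p (size F) * forest_coeff s F else 0 else 0)" .
qed

lemma type_count_add: "type_count (F + G) b = type_count F b + type_count G b"
  by (simp add: type_count_def)

lemma type_count_eq_0: "types_in B F \<Longrightarrow> b \<notin> B \<Longrightarrow> type_count F b = 0"
  by (auto simp: type_count_def types_in_def)

text \<open>For a new type \<open>b\<close>, the only contributing split of \<open>F\<close>
  separates its trees of type \<open>b\<close> from the rest. These parts share no tree, so
  \<open>forest_coeff\<close> factors.\<close>

lemma graded_prod_scalar_power:
  assumes "finite B"
  shows "graded (\<Prod>b\<in>B. fps_scalar_power (1 + tree_series s b) (p b))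
     (\<lambda>F. if types_in B F then (\<Prod>b\<in>B. falling (p b) (type_count F b)) * forest_coeff s F else 0)"
  using assms
proof (induction B)
  case empty
  show ?case
    unfolding prod.empty by (rule graded_cong[OF graded_one]) (auto simp: types_in_def)
next
  case (insert b B)
  let ?g = "\<lambda>X. if types_in {b} X then falling (p b) (size X) * forest_coeff s X else 0"
  let ?h = "\<lambda>X. if types_in B X then (\<Prod>b\<in>B. falling (p b) (type_count X b)) * forest_coeff s X else 0"
  show ?case
    unfolding prod.insert[OF insert.hyps, of "\<lambda>b. fps_scalar_power (1 + tree_series s b) (p b)"]
  proof (rule graded_cong[OF graded_mult[OF graded_scalar_power insert.IH]])
    fix F :: "'a dtree multiset"
    let ?Y = "{#t \<in># F. vtype t [] = b#}"
    let ?Z = "{#t \<in># F. vtype t [] \<noteq> b#}"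
    have FYZ: "F = ?Y + ?Z"
      by (rule multiset_partition)
    then have FY: "F - ?Y = ?Z"
      by (metis add_diff_cancel_left')
    \<comment> \<open>All trees of \<open>X\<close> have type \<open>b\<close>, and none of
      \<open>F - X\<close> do because \<open>b\<close> is not in \<open>B\<close>.\<close>
    have only: "X = ?Y" if "X \<subseteq># F" "types_in {b} X" "types_in B (F - X)" for X
    proof -
      have "?Y = {#t \<in># X. vtype t [] = b#} + {#t \<in># F - X. vtype t [] = b#}"
        using that(1) by (metis filter_union_mset subset_mset.add_diff_inverse)
      moreover have "{#t \<in># X. vtype t [] = b#} = X"
        using that(2) by (auto simp: types_in_def filter_mset_eq_conv)
      moreover have "{#t \<in># F - X. vtype t [] = b#} = {#}"
        using that(3) insert.hyps
        by (auto simp: types_in_def simp del: filter_diff_mset)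
      ultimately show ?thesis by simp
    qed
    have "(\<Sum>X | X \<subseteq># F. ?g X * ?h (F - X)) = (\<Sum>X\<in>{?Y}. ?g X * ?h (F - X))"
      using only by (intro sum.mono_neutral_right finite_subset_mset) auto
    also have "\<dots> = ?g ?Y * ?h ?Z"
      by (simp only: sum.insert finite.emptyI empty_iff not_False_eq_True sum.empty FY add_0_right)
    also have "\<dots> = (if types_in (insert b B) F
        then (\<Prod>b\<in>insert b B. falling (p b) (type_count F b)) * forest_coeff s F else 0)"
    proof (cases "types_in (insert b B) F")
      case True
      have Y: "types_in {b} ?Y" and Z: "types_in B ?Z"
        using True by (auto simp: types_in_def)
      have "type_count F b = size ?Y"
        by (simp add: type_count_def)
      moreover have "type_count F c = type_count ?Z c" if "c \<in> B" for c
        using type_count_add[of ?Y ?Z c] FYZ type_count_eq_0[OF Y, of c] that insert.hyps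
        by auto
      moreover have "forest_coeff s F = forest_coeff s ?Y * forest_coeff s ?Z"
        using forest_coeff_add[of ?Y ?Z s] FYZ by auto
      ultimately show ?thesis
        using True Y Z insert.hyps by (simp add: mult_ac)
    next
      case False
      then have "\<not> types_in B ?Z"
        by (auto simp: types_in_def)
      then show ?thesis
        using False by simp
    qed
    finally show "(\<Sum>X | X \<subseteq># F. ?g X * ?h (F - X)) = (if types_in (insert b B) F
        then (\<Prod>b\<in>insert b B. falling (p b) (type_count F b)) * forest_coeff s F else 0)" .
  qed
qed

subsection \<open>The system\<close>

text \<open>Convergence means that each coefficient is eventually constant: every finite set
  containing the indices active in degree \<open>n\<close> already gives the right
  coefficient.\<close>

lemma has_sum_fpsI:
  fixes f :: "'b \<Rightarrow> 'c::ab_group_add fps"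
  assumes fin: "\<And>n. finite {t \<in> A. fps_nth (f t) n \<noteq> 0}"
    and eq: "\<And>n. fps_nth S n = (\<Sum>t | t \<in> A \<and> fps_nth (f t) n \<noteq> 0. fps_nth (f t) n)"
  shows "(f has_sum S) A"
  unfolding has_sum_def
proof (rule tendsto_fpsI)
  fix n
  let ?I = "{t \<in> A. fps_nth (f t) n \<noteq> 0}"
  have "fps_nth (sum f X) n = fps_nth S n" if "finite X" "?I \<subseteq> X" "X \<subseteq> A" for X
    unfolding eq fps_sum_nth using that by (intro sum.mono_neutral_right) auto
  then show "\<forall>\<^sub>F X in finite_subsets_at_top A. fps_nth (sum f X) n = fps_nth S n"
    unfolding eventually_finite_subsets_at_top using fin[of n] by (intro exI[of _ ?I]) auto
qed

lemma tree_term_has_sum: "(tree_term s has_sum tree_series s a) {t. vtype t [] = a}"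
proof -
  have nth: "fps_nth (tree_term s t) n =
      (if n = weight t then Poly_Mapping.single {#t#} (tree_coeff s t) else 0)" for t :: "'a dtree" and n
    unfolding tree_term_def tree_coeff_def[symmetric]
    by (simp add: scalar_def of_tree_def mult_single)
  show ?thesis
  proof (rule has_sum_fpsI)
    fix n
    let ?I = "{t :: 'a dtree. t \<in> {t. vtype t [] = a} \<and> fps_nth (tree_term s t) n \<noteq> 0}"
    have sub: "?I \<subseteq> {t. vtype t [] = a \<and> weight t = n}"
      by (auto simp: nth split: if_splits)
    then show "finite {t \<in> {t. vtype t [] = a}. fps_nth (tree_term s t) n \<noteq> 0}"
      by (rule finite_subset) (rule finite_weight_eq)
    show "fps_nth (tree_series s a) n = (\<Sum>t\<in>?I. fps_nth (tree_term s t) n)"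
      unfolding tree_series_def fps_nth_Abs_fps
      using sub by (intro sum.mono_neutral_cong_right finite_weight_eq) (auto simp: nth)
  qed
qed

text \<open>The factor \<open>x^k\<close> leaves finitely many \<open>k\<close> in each degree, so
  the sum converges for arbitrary \<open>h\<close>.\<close>

lemma system_has_sum:
  fixes h :: "posnat \<Rightarrow> ('a \<times> posnat, 'k::comm_ring_1) H fps"
  shows "((\<lambda>k. fps_X ^ nat_of_posnat k * B_plus_fps (a, k) (h k)) has_sum
    Abs_fps (\<lambda>n. \<Sum>k | nat_of_posnat k \<le> n. B_plus (a, k) (fps_nth (h k) (n - nat_of_posnat k)))) UNIV"
proof (rule has_sum_fpsI)
  fix n
  let ?f = "\<lambda>k. fps_X ^ nat_of_posnat k * B_plus_fps (a, k) (h k)"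
  have nth: "fps_nth (?f k) n = (if nat_of_posnat k \<le> n
      then B_plus (a, k) (fps_nth (h k) (n - nat_of_posnat k)) else 0)" for k
    by (simp add: fps_X_power_mult_nth B_plus_fps_def)
  have sub: "{k \<in> UNIV. fps_nth (?f k) n \<noteq> 0} \<subseteq> {k. nat_of_posnat k \<le> n}"
    unfolding nth by (auto split: if_splits)
  then show "finite {k \<in> UNIV. fps_nth (?f k) n \<noteq> 0}"
    by (rule finite_subset) (rule finite_posnat_le)
  show "fps_nth (Abs_fps (\<lambda>n. \<Sum>k | nat_of_posnat k \<le> n. B_plus (a, k) (fps_nth (h k) (n - nat_of_posnat k)))) n =
      (\<Sum>k | k \<in> UNIV \<and> fps_nth (?f k) n \<noteq> 0. fps_nth (?f k) n)"
    unfolding fps_nth_Abs_fps using sub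
    by (intro sum.mono_neutral_cong_right finite_posnat_le) (auto simp: nth)
qed

text \<open>The right-hand side always converges and limits are unique, so the system can be read
  coefficient by coefficient.\<close>

lemma solves_system_iff:
  "solves_system s T \<longleftrightarrow> (\<forall>a. fps_nth (T a) 0 = 1) \<and>
     (\<forall>a n. fps_nth (T a - 1) n = (\<Sum>k | nat_of_posnat k \<le> n.
        B_plus (a, k) (fps_nth (T a * Q_series s T ^ nat_of_posnat k) (n - nat_of_posnat k))))"
proof -
  have "((\<lambda>k. fps_X ^ nat_of_posnat k * B_plus_fps (a, k) (T a * Q_series s T ^ nat_of_posnat k))
      has_sum (T a - 1)) UNIV \<longleftrightarrow> T a - 1 = Abs_fps (\<lambda>n. \<Sum>k | nat_of_posnat k \<le> n.
        B_plus (a, k) (fps_nth (T a * Q_series s T ^ nat_of_posnat k) (n - nat_of_posnat k)))"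
    (is "(?f has_sum _) UNIV \<longleftrightarrow> _ = ?S") for a
  proof
    have sum: "(?f has_sum ?S) UNIV"
      by (rule system_has_sum)
    show "T a - 1 = ?S" if "(?f has_sum (T a - 1)) UNIV"
      using infsumI[OF sum] infsumI[OF that] by (rule trans[OF sym, rotated])
    show "(?f has_sum (T a - 1)) UNIV" if "T a - 1 = ?S"
      unfolding that by (rule sum)
  qed
  then show ?thesis
    by (simp add: solves_system_def fps_eq_iff)
qed

section \<open>Existence and uniqueness of the solution\<close>

lemma tree_series_solves: "solves_system s (\<lambda>a. 1 + tree_series s a)"
  unfolding solves_system_iff
proof (intro conjI allI poly_mapping_eqI)
  fix a and n and G :: "'a dtree multiset"
  let ?T = "\<lambda>a. 1 + tree_series s a"
  let ?h = "\<lambda>k. fps_nth (?T a * Q_series s ?T ^ nat_of_posnat k) (n - nat_of_posnat k)"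
  \<comment> \<open>With all types allowed, the forest expansion is exactly the right-hand side of
    \<open>tree_coeff_Node\<close>.\<close>
  have h: "Poly_Mapping.lookup (?h k) F = (if forest_weight F = n - nat_of_posnat k
      then tree_coeff s (Node (a, k) F) else 0)" for k F
    using graded_prod_scalar_power[of UNIV s "exponent s a (nat_of_posnat k)"]
    by (subst mult_Q_series_power) (simp_all add: tree_series_nth_0 graded_def types_in_def tree_coeff_Node)
  have L: "Poly_Mapping.lookup (fps_nth (?T a - 1) n) G =
      (if forest_weight G = n then if size G = 1 \<and> types_in {a} G then forest_coeff s G else 0 else 0)"
    using graded_tree_series[of s a] by (simp add: graded_def)
  show "Poly_Mapping.lookup (fps_nth (?T a - 1) n) G =
      Poly_Mapping.lookup (\<Sum>k | nat_of_posnat k \<le> n. B_plus (a, k) (?h k)) G"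
  proof (cases "size G = 1 \<and> types_in {a} G")
    case True
    then obtain t where t: "G = {#t#}" "vtype t [] = a"
      using size_1_singleton_mset[of G] by (auto simp: types_in_def)
    then obtain k F where G: "G = {#Node (a, k) F#}"
      by (cases t) (auto simp: prod_eq_iff)
    \<comment> \<open>The image of \<open>B_plus (a, k')\<close> contains only trees with root
      decoration \<open>(a, k')\<close>, so the root of \<open>G\<close> selects one
      summand.\<close>
    have "Poly_Mapping.lookup (\<Sum>k | nat_of_posnat k \<le> n. B_plus (a, k) (?h k)) G =
        (\<Sum>k' | nat_of_posnat k' \<le> n. if k' = k then Poly_Mapping.lookup (?h k) F else 0)"
      unfolding lookup_sum G
      by (intro sum.cong) (auto simp: lookup_B_plus intro!: lookup_B_plus_0)
    also have "\<dots> = (if nat_of_posnat k \<le> n then Poly_Mapping.lookup (?h k) F else 0)"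
      by (simp add: finite_posnat_le)
    \<comment> \<open>If \<open>k\<close> exceeds \<open>n\<close>, both sides vanish, since
      \<open>G\<close> then weighs more than \<open>n\<close>.\<close>
    also have "\<dots> = Poly_Mapping.lookup (fps_nth (?T a - 1) n) G"
      unfolding L h using True by (auto simp: G weight_Node)
    finally show ?thesis ..
  next
    case False
    then have "G \<noteq> {#Node (a, k) F#}" for k F
      by (auto simp: types_in_def)
    then show ?thesis
      unfolding L lookup_sum if_not_P[OF False] by (simp add: lookup_B_plus_0)
  qed
qed (simp add: tree_series_nth_0)

text \<open>Congruence modulo \<open>x^(n+1)\<close>.\<close>

definition agree_upto :: "nat \<Rightarrow> 'b fps \<Rightarrow> 'b fps \<Rightarrow> bool" where
  "agree_upto n f g \<longleftrightarrow> (\<forall>i\<le>n. fps_nth f i = fps_nth g i)"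

lemma agree_upto_mult:
  "agree_upto n f g \<Longrightarrow> agree_upto n f' g' \<Longrightarrow> agree_upto n (f * f') (g * g')"
  unfolding agree_upto_def fps_mult_nth by (intro allI impI sum.cong) auto

lemma agree_upto_power: "agree_upto n f g \<Longrightarrow> agree_upto n (f ^ k) (g ^ k)"
  by (induction k) (simp_all add: agree_upto_mult, simp add: agree_upto_def)

lemma agree_upto_prod:
  "(\<And>b. agree_upto n (f b) (g b)) \<Longrightarrow> agree_upto n (\<Prod>b\<in>B. f b) (\<Prod>b\<in>B. g b)"
  by (induction B rule: infinite_finite_induct) (simp_all add: agree_upto_mult, simp_all add: agree_upto_def)

lemma agree_upto_scalar_power:
  assumes "agree_upto n T T'"
  shows "agree_upto n (fps_scalar_power T p) (fps_scalar_power T' p)"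
proof -
  have "agree_upto n ((T - 1) ^ i) ((T' - 1) ^ i)" for i
    using assms by (intro agree_upto_power) (simp add: agree_upto_def)
  then show ?thesis
    by (simp add: agree_upto_def fps_scalar_power_def fps_compose_nth)
qed

lemma solves_system_unique:
  assumes T: "solves_system s T" and T': "solves_system s T'"
  shows "T = T'"
proof -
  have "agree_upto n (T a) (T' a)" for n a
  proof (induction n arbitrary: a)
    case 0
    then show ?case using T T' by (simp add: agree_upto_def solves_system_iff)
  next
    case (Suc n)
    have agree: "agree_upto n (T a * Q_series s T ^ k) (T' a * Q_series s T' ^ k)" for k
      unfolding Q_series_def
      by (intro agree_upto_mult agree_upto_power agree_upto_prod agree_upto_scalar_power Suc.IH)
    \<comment> \<open>Since \<open>k\<close> is at least 1, the degree \<open>Suc n - k\<close> is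
      at most \<open>n\<close>, where the induction hypothesis applies.\<close>
    have "fps_nth (T a * Q_series s T ^ nat_of_posnat k) (Suc n - nat_of_posnat k)
        = fps_nth (T' a * Q_series s T' ^ nat_of_posnat k) (Suc n - nat_of_posnat k)" for k
      using agree[of "nat_of_posnat k"] nat_of_posnat_ge_1[of k] by (simp add: agree_upto_def)
    then have "fps_nth (T a - 1) (Suc n) = fps_nth (T' a - 1) (Suc n)"
      using T[unfolded solves_system_iff, THEN conjunct2, rule_format, of a "Suc n"]
        T'[unfolded solves_system_iff, THEN conjunct2, rule_format, of a "Suc n"] by simp
    then show ?case
      using Suc.IH[of a] by (auto simp: agree_upto_def le_Suc_eq)
  qed
  then show ?thesis
    by (intro ext fps_ext) (auto simp: agree_upto_def)
qed

theorem theorem4p7: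
  fixes s :: "'a::finite \<Rightarrow> 'k::comm_rat_algebra"
  shows "(\<forall>a. tree_term s summable_on {t. vtype t [] = a}) \<and>
    (\<forall>T. solves_system s T \<longleftrightarrow>
      (\<forall>a. T a = 1 + (\<Sum>\<^sub>\<infinity>t\<in>{t. vtype t [] = a}. tree_term s t)))"
proof (intro conjI allI)
  show "tree_term s summable_on {t. vtype t [] = a}" for a
    using tree_term_has_sum by (rule has_sum_imp_summable)
  fix T :: "'a \<Rightarrow> ('a \<times> posnat, 'k) H fps"
  have "solves_system s T \<longleftrightarrow> T = (\<lambda>a. 1 + tree_series s a)"
    using tree_series_solves solves_system_unique by blast
  then show "solves_system s T \<longleftrightarrow>
      (\<forall>a. T a = 1 + (\<Sum>\<^sub>\<infinity>t\<in>{t. vtype t [] = a}. tree_term s t))"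
    by (simp add: infsumI[OF tree_term_has_sum] fun_eq_iff)
qed

end
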